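(* If $V$ is an object of the category $\mathcal{A}_3$ (defined in the context), then there exist a left quasigroup $(G,* )$ satisfying, for all $a,b,c,d\in G$, $$(b*c)*(a\backslash_G((a*c)*((b*c)\backslash_G(b*d))))=b*(a\backslash_G((a*c)*d)),$$ $$(a*c)*((b*c)\backslash_G(b*d))=((a*c)*d)*((b*(a\backslash_G((a*c)*d)))\backslash_G(b*d)),$$ and a bijection $\pi':L_V\to G$ such that $V=[(L_V,(G,\mu^G_3),\pi')]$, where $\mu^G_3(a,b,c)=b*(a\backslash_G c)$ $(a,b,c\in G)$.
   Context: A left quasigroup $(L,\cdot)$ is a nonempty set $L$ with a binary operation such that for all $u,w\in L$ there is a unique $v\in L$ with $u\cdot v=w$; this $v$ is denoted $u\backslash_L w$ (similarly $\backslash_G$ for $(G,* )$). A ternary system $(M,\mu)$ is a nonempty set $M$ with a map $\mu:M^3\to M$; a homomorphism $h:(M,\mu)\to(M',\mu')$ is a map with $h(\mu(a,b,c))=\mu'(h(a),h(b),h(c))$ for all $a,b,c$. Let $LMB$ be the collection of all triplets $(L,M,\pi)$ where $L$ is a left quasigroup, $M=(M,\mu)$ is a ternary system satisfying, for all $a,b,c,d\in M$, $$\mu(a,\mu(a,b,c),\mu(\mu(a,b,c),c,d))=\mu(a,b,\mu(b,c,d)),$$ $$\mu(\mu(a,b,c),c,d)=\mu(\mu(a,b,\mu(b,c,d)),\mu(b,c,d),d),$$ and $\pi:L\to M$ is a bijection. Write $(L,M,\pi)\sim(L',M',\pi')$ iff $L=L'$ as left quasigroups and $\pi'\pi^{-1}:M\to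 M'$ is a homomorphism of ternary systems (an equivalence relation). Objects of the category $\mathcal{A}$ are the equivalence classes $[(L,M,\pi)]$; $L_V$ denotes the common left quasigroup of all representatives of $V$. $V$ is an object of $\mathcal{A}_3$ iff it is an object of $\mathcal{A}$ having a representative $(L,(M,\mu),\pi)$ such that $\mu(a,b,c)=\mu(d,b,\mu(a,d,c))$ and $\mu(a,a,b)=b$ for all $a,b,c,d\in M$. *)

theory Defs
  imports "HOL-Algebra.Congruence"
begin

text \<open>
  All structures live on carrier sets. Operations and maps are taken extensional
  (\<open>undefined\<close> outside the carrier), so that HOL equality of two structures or maps is
  equality of the carriers and of the values on them. In particular the condition
  \<open>L = L'\<close> on left quasigroups can be stated as plain equality.

  The types \<open>'a\<close> and \<open>'m\<close> play the role of the universes over which the left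
  quasigroups \<open>L\<close> and the ternary systems \<open>M\<close> of the triplets range.
\<close>

record 'a left_quasigroup = "'a partial_object" +
  lq_mult :: "'a \<Rightarrow> 'a \<Rightarrow> 'a" (infixl \<open>\<cdot>\<index>\<close> 70)

definition is_left_quasigroup :: "'a left_quasigroup \<Rightarrow> bool" where
  "is_left_quasigroup L \<longleftrightarrow>
     carrier L \<noteq> {} \<and>
     lq_mult L \<in> carrier L \<rightarrow>\<^sub>E carrier L \<rightarrow>\<^sub>E carrier L \<and>
     (\<forall>u\<in>carrier L. \<forall>w\<in>carrier L. \<exists>!v. v \<in> carrier L \<and> u \<cdot>\<^bsub>L\<^esub> v = w)"

definition lq_ldiv :: "'a left_quasigroup \<Rightarrow> 'a \<Rightarrow> 'a \<Rightarrow> 'a" (infixl \<open>\<setminus>\<index>\<close> 70) where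
  "u \<setminus>\<^bsub>L\<^esub> w = (THE v. v \<in> carrier L \<and> u \<cdot>\<^bsub>L\<^esub> v = w)"

record 'm ternary_system = "'m partial_object" +
  tern :: "'m \<Rightarrow> 'm \<Rightarrow> 'm \<Rightarrow> 'm"

definition is_ternary_system :: "'m ternary_system \<Rightarrow> bool" where
  "is_ternary_system M \<longleftrightarrow>
     carrier M \<noteq> {} \<and>
     tern M \<in> carrier M \<rightarrow>\<^sub>E carrier M \<rightarrow>\<^sub>E carrier M \<rightarrow>\<^sub>E carrier M"

definition ternary_hom :: "'m ternary_system \<Rightarrow> 'n ternary_system \<Rightarrow> ('m \<Rightarrow> 'n) set" where
  "ternary_hom M M' =
     {h. h \<in> carrier M \<rightarrow> carrier M' \<and>
         (\<forall>a\<in>carrier M. \<forall>b\<in>carrier M. \<forall>c\<in>carrier M.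
            h (tern M a b c) = tern M' (h a) (h b) (h c))}"

type_synonym ('a, 'm) triplet = "'a left_quasigroup \<times> 'm ternary_system \<times> ('a \<Rightarrow> 'm)"

definition LMB :: "('a, 'm) triplet set" where
  "LMB = {(L, M, \<pi>).
     is_left_quasigroup L \<and> is_ternary_system M \<and>
     (let \<mu> = tern M in
        \<forall>a\<in>carrier M. \<forall>b\<in>carrier M. \<forall>c\<in>carrier M. \<forall>d\<in>carrier M.
          \<mu> a (\<mu> a b c) (\<mu> (\<mu> a b c) c d) = \<mu> a b (\<mu> b c d) \<and>
          \<mu> (\<mu> a b c) c d = \<mu> (\<mu> a b (\<mu> b c d)) (\<mu> b c d) d) \<and>
     \<pi> \<in> carrier L \<rightarrow>\<^sub>E carrier M \<and> bij_betw \<pi> (carrier L) (carrier M)}"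

definition LMB_rel :: "(('a, 'm) triplet \<times> ('a, 'm) triplet) set" where
  "LMB_rel = {((L, M, \<pi>), (L', M', \<pi>')).
     (L, M, \<pi>) \<in> LMB \<and> (L', M', \<pi>') \<in> LMB \<and> L = L' \<and>
     \<pi>' \<circ> inv_into (carrier L) \<pi> \<in> ternary_hom M M'}"

definition LMB_class :: "('a, 'm) triplet \<Rightarrow> ('a, 'm) triplet set" where
  "LMB_class T = LMB_rel `` {T}"

definition objects_A :: "('a, 'm) triplet set set" where
  "objects_A = LMB // LMB_rel"

definition lq_of :: "('a, 'm) triplet set \<Rightarrow> 'a left_quasigroup" where
  "lq_of V = (THE L. \<forall>T\<in>V. fst T = L)"

definition objects_A3 :: "('a, 'm) triplet set set" where
  "objects_A3 = {V \<in> objects_A. \<exists>(L, M, \<pi>)\<in>V.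
     let \<mu> = tern M in
       (\<forall>a\<in>carrier M. \<forall>b\<in>carrier M. \<forall>c\<in>carrier M. \<forall>d\<in>carrier M.
          \<mu> a b c = \<mu> d b (\<mu> a d c)) \<and>
       (\<forall>a\<in>carrier M. \<forall>b\<in>carrier M. \<mu> a a b = b)}"

definition ternary3 :: "'m left_quasigroup \<Rightarrow> 'm ternary_system" where
  "ternary3 G = \<lparr>carrier = carrier G,
     tern = (\<lambda>a\<in>carrier G. \<lambda>b\<in>carrier G. \<lambda>c\<in>carrier G. b \<cdot>\<^bsub>G\<^esub> (a \<setminus>\<^bsub>G\<^esub> c))\<rparr>"

lemma equiv_LMB_rel: "equiv (LMB :: ('a, 'm) triplet set) LMB_rel"
proof (rule equivI)
  let ?R = "LMB_rel :: (('a, 'm) triplet \<times> ('a, 'm) triplet) set"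
  show "?R \<subseteq> LMB \<times> LMB"
    by (auto simp: LMB_rel_def)
  show "refl_on LMB ?R"
  proof (rule refl_onI)
    fix T :: "('a, 'm) triplet" assume T: "T \<in> LMB"
    obtain L M p where [simp]: "T = (L, M, p)" by (cases T)
    have b: "bij_betw p (carrier L) (carrier M)" and t: "is_ternary_system M"
      using T by (auto simp: LMB_def)
    have cl: "tern M x y z \<in> carrier M"
      if "x \<in> carrier M" "y \<in> carrier M" "z \<in> carrier M" for x y z
      using t that by (auto simp: is_ternary_system_def PiE_def Pi_def)
    have i: "p (inv_into (carrier L) p x) = x" if "x \<in> carrier M" for x
      using b that by (simp add: bij_betw_inv_into_right)
    have "p \<circ> inv_into (carrier L) p \<in> ternary_hom M M"
      by (auto simp: ternary_hom_def i cl)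
    then show "(T, T) \<in> LMB_rel"
      using T by (simp add: LMB_rel_def)
  qed
  show "sym ?R"
  proof (rule symI, clarsimp simp: LMB_rel_def)
    fix L :: "'a left_quasigroup" and M M' :: "'m ternary_system" and p p'
    assume T: "(L, M, p) \<in> LMB" and T': "(L, M', p') \<in> LMB"
      and h: "p' \<circ> inv_into (carrier L) p \<in> ternary_hom M M'"
    define f where "f = p' \<circ> inv_into (carrier L) p"
    define g where "g = p \<circ> inv_into (carrier L) p'"
    have b: "bij_betw p (carrier L) (carrier M)" "bij_betw p' (carrier L) (carrier M')"
      and t: "is_ternary_system M" "is_ternary_system M'"
      using T T' by (auto simp: LMB_def)
    have cl: "tern M x y z \<in> carrier M"
      if "x \<in> carrier M" "y \<in> carrier M" "z \<in> carrier M" for x y z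
      using t that by (auto simp: is_ternary_system_def PiE_def Pi_def)
    have gc: "g x \<in> carrier M" if "x \<in> carrier M'" for x
      using b that unfolding g_def comp_def
      by (meson bij_betwE bij_betw_inv_into)
    have fg: "f (g x) = x" if "x \<in> carrier M'" for x
      using b that unfolding g_def f_def comp_def
      by (metis bij_betwE bij_betw_inv_into bij_betw_inv_into_left bij_betw_inv_into_right)
    have gf: "g (f x) = x" if "x \<in> carrier M" for x
      using b that unfolding g_def f_def comp_def
      by (metis bij_betwE bij_betw_inv_into bij_betw_inv_into_left bij_betw_inv_into_right)
    have fh: "f (tern M x y z) = tern M' (f x) (f y) (f z)"
      if "x \<in> carrier M" "y \<in> carrier M" "z \<in> carrier M" for x y z
      using h that by (auto simp: ternary_hom_def f_def)
    have "g (tern M' x y z) = tern M (g x) (g y) (g z)"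
      if "x \<in> carrier M'" "y \<in> carrier M'" "z \<in> carrier M'" for x y z
      using fh[OF gc[OF that(1)] gc[OF that(2)] gc[OF that(3)]] that
      by (metis cl fg gc gf)
    then show "p \<circ> inv_into (carrier L) p' \<in> ternary_hom M' M"
      using gc by (auto simp: ternary_hom_def g_def)
  qed
  show "trans ?R"
  proof (rule transI, clarsimp simp: LMB_rel_def)
    fix L :: "'a left_quasigroup" and M M' M'' :: "'m ternary_system" and p p' p''
    assume T: "(L, M, p) \<in> LMB" and T': "(L, M', p') \<in> LMB" and T'': "(L, M'', p'') \<in> LMB"
      and h: "p' \<circ> inv_into (carrier L) p \<in> ternary_hom M M'"
      and h': "p'' \<circ> inv_into (carrier L) p' \<in> ternary_hom M' M''"
    define f where "f = p' \<circ> inv_into (carrier L) p"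
    define g where "g = p'' \<circ> inv_into (carrier L) p'"
    have b: "bij_betw p (carrier L) (carrier M)" "bij_betw p' (carrier L) (carrier M')"
      and t: "is_ternary_system M"
      using T T' by (auto simp: LMB_def)
    have cl: "tern M x y z \<in> carrier M"
      if "x \<in> carrier M" "y \<in> carrier M" "z \<in> carrier M" for x y z
      using t that by (auto simp: is_ternary_system_def PiE_def Pi_def)
    have eq: "(p'' \<circ> inv_into (carrier L) p) x = g (f x)" if "x \<in> carrier M" for x
      using b that unfolding g_def f_def comp_def
      by (metis bij_betwE bij_betw_inv_into bij_betw_inv_into_left)
    have "f \<in> ternary_hom M M'" "g \<in> ternary_hom M' M''"
      using h h' by (simp_all add: f_def g_def)
    moreover from this have "f x \<in> carrier M'" if "x \<in> carrier M" for x
      using that by (auto simp: ternary_hom_def)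
    ultimately show "p'' \<circ> inv_into (carrier L) p \<in> ternary_hom M M''"
      unfolding ternary_hom_def using eq cl by (auto simp del: comp_apply)
  qed
qed

lemma lq_of_eq:
  assumes "V \<in> objects_A" and "(L, M, \<pi>) \<in> V"
  shows "lq_of V = L"
proof -
  obtain T where "V = LMB_rel `` {T}"
    using assms(1) by (auto simp: objects_A_def quotient_def)
  then have "\<forall>S\<in>V. fst S = L"
    using assms(2) by (auto simp: LMB_rel_def)
  then show ?thesis
    unfolding lq_of_def using assms(2) by (intro the_equality) force+
qed

end

theory Submission
  imports Defs
begin

text \<open>
  Write \<open>P a b\<close> for the map \<open>\<mu> a b\<close> and read it as a transport from \<open>a\<close> to \<open>b\<close>. The two
  laws that single out the objects of \<open>\<A>\<^sub>3\<close> say exactly that transport is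
  path-independent: \<open>P d b \<circ> P a d = P a b\<close> and \<open>P a a = id\<close>. Such a system is
  determined by the transports out of one base point \<open>e\<close>. Each of them is a
  permutation, \<open>P b e\<close> being inverse to \<open>P e b\<close>, so \<open>b * c = P e b c\<close> is a left
  quasigroup with left division \<open>a \ c = P a e c\<close>; and
  \<open>b * (a \ c) = P e b (P a e c) = P a b c\<close> is the original operation \<open>\<mu> a b c\<close>.

  The two identities demanded of \<open>*\<close> are the two defining laws of \<open>LMB\<close>, taken at
  \<open>\<mu> a b c = b * (a \ c)\<close> after the substitution \<open>c \<mapsto> a * c\<close>, \<open>d \<mapsto> b * d\<close>. Since the
  ternary system itself is recovered, not merely an isomorphic copy, the bijection of the
  chosen representative can be kept.
\<close>

lemma tern_closed:
  assumes "is_ternary_system M" "a \<in> carrier M" "b \<in> carrier M" "c \<in> carrier M"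
  shows "tern M a b c \<in> carrier M"
  using assms unfolding is_ternary_system_def by (meson PiE_mem)

lemma lq_mult_closed:
  assumes "is_left_quasigroup G" "u \<in> carrier G" "v \<in> carrier G"
  shows "u \<cdot>\<^bsub>G\<^esub> v \<in> carrier G"
  using assms unfolding is_left_quasigroup_def by (meson PiE_mem)

lemma lq_ldiv_eqI:
  assumes "is_left_quasigroup G" "u \<in> carrier G" "v \<in> carrier G" "u \<cdot>\<^bsub>G\<^esub> v = w"
  shows "u \<setminus>\<^bsub>G\<^esub> w = v"
proof -
  have "w \<in> carrier G"
    using lq_mult_closed[OF assms(1-3)] assms(4) by simp
  then have "\<exists>!v. v \<in> carrier G \<and> u \<cdot>\<^bsub>G\<^esub> v = w"
    using assms(1,2) unfolding is_left_quasigroup_def by simp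
  then show ?thesis
    unfolding lq_ldiv_def by (rule the1_equality) (simp add: assms)
qed

lemma lq_ldiv_mult:
  assumes "is_left_quasigroup G" "u \<in> carrier G" "v \<in> carrier G"
  shows "u \<setminus>\<^bsub>G\<^esub> (u \<cdot>\<^bsub>G\<^esub> v) = v"
  using assms refl by (rule lq_ldiv_eqI)

definition transport_lq :: "'m ternary_system \<Rightarrow> 'm \<Rightarrow> 'm left_quasigroup" where
  "transport_lq M e = \<lparr>carrier = carrier M, lq_mult = tern M e\<rparr>"

lemma carrier_transport_lq [simp]: "carrier (transport_lq M e) = carrier M"
  by (simp add: transport_lq_def)

lemma mult_transport_lq [simp]: "b \<cdot>\<^bsub>transport_lq M e\<^esub> c = tern M e b c"
  by (simp add: transport_lq_def)

text \<open>
  Path-independence applied to the round trips \<open>e \<rightarrow> u \<rightarrow> e\<close> and \<open>u \<rightarrow> e \<rightarrow> u\<close> makes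
  the transports \<open>e \<rightarrow> u\<close> and \<open>u \<rightarrow> e\<close> mutually inverse.
\<close>

lemma is_left_quasigroup_transport_lq:
  assumes M: "is_ternary_system M" and e: "e \<in> carrier M"
    and comp: "\<And>a b c d. \<lbrakk>a \<in> carrier M; b \<in> carrier M; c \<in> carrier M; d \<in> carrier M\<rbrakk>
      \<Longrightarrow> tern M d b (tern M a d c) = tern M a b c"
    and idt: "\<And>a b. \<lbrakk>a \<in> carrier M; b \<in> carrier M\<rbrakk> \<Longrightarrow> tern M a a b = b"
  shows "is_left_quasigroup (transport_lq M e)"
proof -
  have "\<exists>!v. v \<in> carrier M \<and> tern M e u v = w" if u: "u \<in> carrier M" and w: "w \<in> carrier M" for u w
  proof (rule ex1I)
    show "tern M u e w \<in> carrier M \<and> tern M e u (tern M u e w) = w"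
      using u w e by (simp add: tern_closed[OF M] comp idt)
  next
    fix v assume "v \<in> carrier M \<and> tern M e u v = w"
    then show "v = tern M u e w"
      using comp[of e e v u] idt[of e v] u e by (elim conjE) simp
  qed
  moreover have "tern M e \<in> carrier M \<rightarrow>\<^sub>E carrier M \<rightarrow>\<^sub>E carrier M"
    using M e unfolding is_ternary_system_def by (meson PiE_mem)
  moreover have "carrier M \<noteq> {}"
    using e by blast
  ultimately show ?thesis
    by (simp add: is_left_quasigroup_def transport_lq_def)
qed

text \<open>
  Extensionality of \<open>tern M\<close> turns agreement on the carrier into equality of structures.
\<close>

lemma ternary3_transport_lq:
  assumes M: "is_ternary_system M" and e: "e \<in> carrier M"
    and comp: "\<And>a b c d. \<lbrakk>a \<in> carrier M; b \<in> carrier M; c \<in> carrier M; d \<in> carrier M\<rbrakk>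
      \<Longrightarrow> tern M d b (tern M a d c) = tern M a b c"
    and idt: "\<And>a b. \<lbrakk>a \<in> carrier M; b \<in> carrier M\<rbrakk> \<Longrightarrow> tern M a a b = b"
  shows "ternary3 (transport_lq M e) = M"
proof -
  let ?G = "transport_lq M e"
  note G = is_left_quasigroup_transport_lq[OF M e comp idt]
  have ldiv: "a \<setminus>\<^bsub>?G\<^esub> c = tern M a e c" if "a \<in> carrier M" "c \<in> carrier M" for a c
    by (rule lq_ldiv_eqI[OF G]) (use that e in \<open>simp_all add: tern_closed[OF M] comp idt\<close>)
  have ext: "tern M \<in> carrier M \<rightarrow>\<^sub>E carrier M \<rightarrow>\<^sub>E carrier M \<rightarrow>\<^sub>E carrier M"
    using M by (simp add: is_ternary_system_def)
  have "tern (ternary3 ?G)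
      = (\<lambda>a\<in>carrier M. \<lambda>b\<in>carrier M. \<lambda>c\<in>carrier M. tern M a b c)"
    using e by (auto simp: ternary3_def ldiv comp intro!: restrict_ext)
  also have "\<dots> = (\<lambda>a\<in>carrier M. \<lambda>b\<in>carrier M. tern M a b)"
    by (intro restrict_ext PiE_restrict) (rule PiE_mem[OF PiE_mem[OF ext]])
  also have "\<dots> = (\<lambda>a\<in>carrier M. tern M a)"
    by (intro restrict_ext PiE_restrict) (rule PiE_mem[OF ext])
  also have "\<dots> = tern M"
    using ext by (rule PiE_restrict)
  finally have "tern (ternary3 ?G) = tern M" .
  moreover have "carrier (ternary3 ?G) = carrier M"
    by (simp add: ternary3_def)
  ultimately show ?thesis
    by (cases M) (simp add: ternary3_def)
qed

text \<open>
  In \<open>\<mu> x y (x * z) = y * z\<close> the left division cancels. Putting \<open>a * c\<close> and \<open>b * d\<close> for the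
  last two arguments of the laws therefore replaces \<open>\<mu> a b c\<close> by \<open>b * c\<close> and
  \<open>\<mu> b c d\<close> by \<open>(a * c) * d\<close>, which yields the binary identities.
\<close>

lemma binary_identities_of_ternary3:
  fixes G :: "'m left_quasigroup"
  defines "\<mu> \<equiv> tern (ternary3 G)"
  assumes G: "is_left_quasigroup G"
    and law1: "\<And>a b c d. \<lbrakk>a \<in> carrier G; b \<in> carrier G; c \<in> carrier G; d \<in> carrier G\<rbrakk>
      \<Longrightarrow> \<mu> a (\<mu> a b c) (\<mu> (\<mu> a b c) c d) = \<mu> a b (\<mu> b c d)"
    and law2: "\<And>a b c d. \<lbrakk>a \<in> carrier G; b \<in> carrier G; c \<in> carrier G; d \<in> carrier G\<rbrakk>
      \<Longrightarrow> \<mu> (\<mu> a b c) c d = \<mu> (\<mu> a b (\<mu> b c d)) (\<mu> b c d) d"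
    and carr: "a \<in> carrier G" "b \<in> carrier G" "c \<in> carrier G" "d \<in> carrier G"
  shows "(b \<cdot>\<^bsub>G\<^esub> c) \<cdot>\<^bsub>G\<^esub> (a \<setminus>\<^bsub>G\<^esub> ((a \<cdot>\<^bsub>G\<^esub> c) \<cdot>\<^bsub>G\<^esub> ((b \<cdot>\<^bsub>G\<^esub> c) \<setminus>\<^bsub>G\<^esub> (b \<cdot>\<^bsub>G\<^esub> d))))
      = b \<cdot>\<^bsub>G\<^esub> (a \<setminus>\<^bsub>G\<^esub> ((a \<cdot>\<^bsub>G\<^esub> c) \<cdot>\<^bsub>G\<^esub> d))" (is ?first)
    and "(a \<cdot>\<^bsub>G\<^esub> c) \<cdot>\<^bsub>G\<^esub> ((b \<cdot>\<^bsub>G\<^esub> c) \<setminus>\<^bsub>G\<^esub> (b \<cdot>\<^bsub>G\<^esub> d))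
      = ((a \<cdot>\<^bsub>G\<^esub> c) \<cdot>\<^bsub>G\<^esub> d) \<cdot>\<^bsub>G\<^esub>
        ((b \<cdot>\<^bsub>G\<^esub> (a \<setminus>\<^bsub>G\<^esub> ((a \<cdot>\<^bsub>G\<^esub> c) \<cdot>\<^bsub>G\<^esub> d))) \<setminus>\<^bsub>G\<^esub> (b \<cdot>\<^bsub>G\<^esub> d))" (is ?second)
proof -
  note cl = lq_mult_closed[OF G]
  have mu: "\<mu> x y z = y \<cdot>\<^bsub>G\<^esub> (x \<setminus>\<^bsub>G\<^esub> z)"
    if "x \<in> carrier G" "y \<in> carrier G" "z \<in> carrier G" for x y z
    using that by (simp add: \<mu>_def ternary3_def)
  have ldiv_closed: "x \<setminus>\<^bsub>G\<^esub> z \<in> carrier G" if "x \<in> carrier G" "z \<in> carrier G" for x z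
  proof -
    have "\<exists>!v. v \<in> carrier G \<and> x \<cdot>\<^bsub>G\<^esub> v = z"
      using G that unfolding is_left_quasigroup_def by simp
    then obtain v where "v \<in> carrier G" "x \<cdot>\<^bsub>G\<^esub> v = z"
      by (elim ex1E conjE)
    then show ?thesis
      using lq_ldiv_eqI[OF G that(1)] by simp
  qed
  show ?first ?second
    using law1[of a b "a \<cdot>\<^bsub>G\<^esub> c" "b \<cdot>\<^bsub>G\<^esub> d"] law2[of a b "a \<cdot>\<^bsub>G\<^esub> c" "b \<cdot>\<^bsub>G\<^esub> d"] carr
    by (simp_all add: mu cl ldiv_closed lq_ldiv_mult[OF G])
qed

theorem proposition6p19:
  fixes V :: "('a, 'm) triplet set"
  assumes "V \<in> objects_A3"
  shows "\<exists>(G :: 'm left_quasigroup) \<pi>'.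
    is_left_quasigroup G \<and>
    (\<forall>a\<in>carrier G. \<forall>b\<in>carrier G. \<forall>c\<in>carrier G. \<forall>d\<in>carrier G.
      (b \<cdot>\<^bsub>G\<^esub> c) \<cdot>\<^bsub>G\<^esub> (a \<setminus>\<^bsub>G\<^esub> ((a \<cdot>\<^bsub>G\<^esub> c) \<cdot>\<^bsub>G\<^esub> ((b \<cdot>\<^bsub>G\<^esub> c) \<setminus>\<^bsub>G\<^esub> (b \<cdot>\<^bsub>G\<^esub> d))))
        = b \<cdot>\<^bsub>G\<^esub> (a \<setminus>\<^bsub>G\<^esub> ((a \<cdot>\<^bsub>G\<^esub> c) \<cdot>\<^bsub>G\<^esub> d)) \<and>
      (a \<cdot>\<^bsub>G\<^esub> c) \<cdot>\<^bsub>G\<^esub> ((b \<cdot>\<^bsub>G\<^esub> c) \<setminus>\<^bsub>G\<^esub> (b \<cdot>\<^bsub>G\<^esub> d))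
        = ((a \<cdot>\<^bsub>G\<^esub> c) \<cdot>\<^bsub>G\<^esub> d) \<cdot>\<^bsub>G\<^esub>
          ((b \<cdot>\<^bsub>G\<^esub> (a \<setminus>\<^bsub>G\<^esub> ((a \<cdot>\<^bsub>G\<^esub> c) \<cdot>\<^bsub>G\<^esub> d))) \<setminus>\<^bsub>G\<^esub> (b \<cdot>\<^bsub>G\<^esub> d))) \<and>
    \<pi>' \<in> carrier (lq_of V) \<rightarrow>\<^sub>E carrier G \<and>
    bij_betw \<pi>' (carrier (lq_of V)) (carrier G) \<and>
    V = LMB_class (lq_of V, ternary3 G, \<pi>')"
proof -
  obtain L M \<pi> where V: "V \<in> objects_A" and inV: "(L, M, \<pi>) \<in> V"
    and comp: "\<And>a b c d. \<lbrakk>a \<in> carrier M; b \<in> carrier M; c \<in> carrier M; d \<in> carrier M\<rbrakk>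
      \<Longrightarrow> tern M d b (tern M a d c) = tern M a b c"
    and idt: "\<And>a b. \<lbrakk>a \<in> carrier M; b \<in> carrier M\<rbrakk> \<Longrightarrow> tern M a a b = b"
  proof -
    from assms obtain T where "V \<in> objects_A" "T \<in> V"
      and T: "case T of (L, M, \<pi>) \<Rightarrow>
        (\<forall>a\<in>carrier M. \<forall>b\<in>carrier M. \<forall>c\<in>carrier M. \<forall>d\<in>carrier M.
          tern M a b c = tern M d b (tern M a d c)) \<and>
        (\<forall>a\<in>carrier M. \<forall>b\<in>carrier M. tern M a a b = b)"
      unfolding objects_A3_def Let_def by blast
    moreover obtain L M \<pi> where TLM: "T = (L, M, \<pi>)"
      by (cases T)
    ultimately have "V \<in> objects_A" "(L, M, \<pi>) \<in> V" by blast+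
    moreover have "tern M d b (tern M a d c) = tern M a b c"
      if "a \<in> carrier M" "b \<in> carrier M" "c \<in> carrier M" "d \<in> carrier M" for a b c d
      using T that unfolding TLM prod.case by metis
    moreover have "tern M a a b = b" if "a \<in> carrier M" "b \<in> carrier M" for a b
      using T that unfolding TLM prod.case by blast
    ultimately show thesis
      by (rule that)
  qed
  have T: "(L, M, \<pi>) \<in> LMB"
    using V inV equiv_LMB_rel unfolding objects_A_def by (metis Union_quotient UnionI)
  have V_eq: "V = LMB_class (L, M, \<pi>)"
  proof -
    obtain S where "S \<in> LMB" "V = LMB_rel `` {S}"
      using V by (auto simp: objects_A_def quotient_def)
    then show ?thesis
      using inV equiv_class_eq[OF equiv_LMB_rel, of S "(L, M, \<pi>)"]
      by (simp add: LMB_class_def)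
  qed
  have L: "lq_of V = L"
    using V inV by (rule lq_of_eq)
  have M: "is_ternary_system M"
    and pi: "\<pi> \<in> carrier L \<rightarrow>\<^sub>E carrier M" "bij_betw \<pi> (carrier L) (carrier M)"
    using T by (simp_all add: LMB_def)
  obtain e where e: "e \<in> carrier M"
    using M by (auto simp: is_ternary_system_def)
  let ?G = "transport_lq M e"
  have G: "is_left_quasigroup ?G" and t3: "ternary3 ?G = M"
    using is_left_quasigroup_transport_lq[OF M e comp idt] ternary3_transport_lq[OF M e comp idt]
    by blast+
  have law1: "tern M a (tern M a b c) (tern M (tern M a b c) c d) = tern M a b (tern M b c d)"
    and law2: "tern M (tern M a b c) c d = tern M (tern M a b (tern M b c d)) (tern M b c d) d"
    if "a \<in> carrier M" "b \<in> carrier M" "c \<in> carrier M" "d \<in> carrier M" for a b c d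
    using T that unfolding LMB_def Let_def by blast+
  note identities = binary_identities_of_ternary3[OF G, unfolded t3 carrier_transport_lq, OF law1 law2]
  show ?thesis
  proof (intro exI conjI ballI)
    show "V = LMB_class (lq_of V, ternary3 ?G, \<pi>)"
      unfolding L t3 by (rule V_eq)
  qed (use G pi identities in \<open>simp_all only: L carrier_transport_lq\<close>)
qed

end
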